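(* Let $N, R$ be positive integers and $F_R \colon \{-1,1\}^R \to \{-1,1\}$ any function. Let $\mathcal{D}_{N,R}$ be the set of tuples $(y_0, y_1, \dots, y_R) \in (\{-1,1\}^N)^{R+1}$, writing $y_i = (y_{i1},\dots,y_{iN})$, such that for every $j \in [N]$ there is exactly one $i \in \{0,1,\dots,R\}$ with $y_{ij} = -1$. Define $G^{\mathrm{prop}} \colon \mathcal{D}_{N,R} \to \{-1,1\}$ by $G^{\mathrm{prop}}(y_0,\dots,y_R) = F_R(\mathsf{OR}_N(y_1), \dots, \mathsf{OR}_N(y_R))$. Let $G^{\le N}$ be the function $(x_1,\dots,x_R) \mapsto F_R(\mathsf{OR}_N(x_1),\dots,\mathsf{OR}_N(x_R))$ restricted to the domain $\{x \in (\{-1,1\}^N)^R : |x| \le N\}$. Then for every $\varepsilon > 0$, $$\widetilde{\deg}_\varepsilon(G^{\mathrm{prop}}) \ge \widetilde{\deg}_\varepsilon(G^{\le N}).$$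
   Context: $\mathsf{OR}_N \colon \{-1,1\}^N \to \{-1,1\}$ outputs $-1$ iff some input equals $-1$ ($-1$ is TRUE). For $x \in \{-1,1\}^M$, $|x|$ denotes the number of coordinates equal to $-1$. For a function $h$ defined on a finite subset $\mathcal{X} \subseteq \mathbb{R}^n$, $\widetilde{\deg}_\varepsilon(h)$ is the least degree of a real polynomial $p$ on $\mathbb{R}^n$ with $|p(x) - h(x)| \le \varepsilon$ for all $x \in \mathcal{X}$ (no constraint outside $\mathcal{X}$). *)

theory Defs
  imports Complex_Main "HOL-Library.FuncSet" "HOL-Library.Poly_Mapping"
begin

text \<open>
  A monomial is a finitely supported exponent function, a polynomial a finitely supported
  assignment of real coefficients to monomials. The type \<open>'v\<close> names the variables; polynomials
  on the finite-dimensional space with coordinates \<open>V\<close> are those with \<open>mpoly_vars p \<subseteq> V\<close>.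
\<close>

type_synonym 'v monomial = "'v \<Rightarrow>\<^sub>0 nat"
type_synonym 'v mpoly = "'v monomial \<Rightarrow>\<^sub>0 real"

definition mpoly_vars :: "'v mpoly \<Rightarrow> 'v set" where
  "mpoly_vars p = (\<Union>m\<in>Poly_Mapping.keys p. Poly_Mapping.keys m)"

definition monomial_eval :: "'v monomial \<Rightarrow> ('v \<Rightarrow> real) \<Rightarrow> real" where
  "monomial_eval m x = (\<Prod>v\<in>Poly_Mapping.keys m. x v ^ Poly_Mapping.lookup m v)"

definition mpoly_eval :: "'v mpoly \<Rightarrow> ('v \<Rightarrow> real) \<Rightarrow> real" where
  "mpoly_eval p x = (\<Sum>m\<in>Poly_Mapping.keys p. Poly_Mapping.lookup p m * monomial_eval m x)"

definition monomial_degree :: "'v monomial \<Rightarrow> nat" where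
  "monomial_degree m = (\<Sum>v\<in>Poly_Mapping.keys m. Poly_Mapping.lookup m v)"

text \<open>Total degree; the zero polynomial has degree 0, like the other constants.\<close>

definition mpoly_degree :: "'v mpoly \<Rightarrow> nat" where
  "mpoly_degree p = Max (insert 0 (monomial_degree ` Poly_Mapping.keys p))"

text \<open>
  \<open>approx_deg V \<epsilon> X h\<close> is the \<open>\<epsilon>\<close>-approximate degree of \<open>h\<close> restricted to the domain \<open>X\<close>, a finite
  set of points in the space with coordinates \<open>V\<close>; values of \<open>h\<close> outside \<open>X\<close> are irrelevant. For
  such \<open>X\<close> and \<open>\<epsilon> \<ge> 0\<close> an interpolating polynomial exists, so the minimum is over a nonempty set.
\<close>

definition approx_deg ::
  "'v set \<Rightarrow> real \<Rightarrow> ('v \<Rightarrow> real) set \<Rightarrow> (('v \<Rightarrow> real) \<Rightarrow> real) \<Rightarrow> nat" where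
  "approx_deg V \<epsilon> X h =
     (LEAST d. \<exists>p. mpoly_vars p \<subseteq> V \<and> mpoly_degree p = d \<and>
                   (\<forall>x\<in>X. \<bar>mpoly_eval p x - h x\<bar> \<le> \<epsilon>))"

text \<open>
  Sign vectors indexed by \<open>I\<close> are extensional functions (undefined outside \<open>I\<close>), so that each
  sign vector is represented exactly once; \<open>-1\<close> is TRUE.
\<close>

definition sign_cube :: "'i set \<Rightarrow> ('i \<Rightarrow> real) set" where
  "sign_cube I = I \<rightarrow>\<^sub>E {-1, 1}"

definition weight :: "'i set \<Rightarrow> ('i \<Rightarrow> real) \<Rightarrow> nat" where
  "weight I x = card {i \<in> I. x i = -1}"

definition OR_fun :: "nat \<Rightarrow> (nat \<Rightarrow> real) \<Rightarrow> real" where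
  "OR_fun N x = (if \<exists>j\<in>{1..N}. x j = -1 then -1 else 1)"

text \<open>
  A tuple of blocks is a vector indexed by pairs: \<open>y (i, j)\<close> is coordinate \<open>j\<close> of block \<open>i\<close>.
\<close>

definition block :: "nat \<Rightarrow> (nat \<times> nat \<Rightarrow> real) \<Rightarrow> nat \<Rightarrow> (nat \<Rightarrow> real)" where
  "block N y i = (\<lambda>j\<in>{1..N}. y (i, j))"

definition D_prop :: "nat \<Rightarrow> nat \<Rightarrow> (nat \<times> nat \<Rightarrow> real) set" where
  "D_prop N R = {y \<in> sign_cube ({0..R} \<times> {1..N}).
                   \<forall>j\<in>{1..N}. \<exists>!i. i \<in> {0..R} \<and> y (i, j) = -1}"

definition D_le :: "nat \<Rightarrow> nat \<Rightarrow> (nat \<times> nat \<Rightarrow> real) set" where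
  "D_le N R = {x \<in> sign_cube ({1..R} \<times> {1..N}). weight ({1..R} \<times> {1..N}) x \<le> N}"

text \<open>
  The composition of \<open>F\<close> with OR on blocks \<open>1, \<dots>, R\<close>. Block 0, if present, is ignored, so the same
  expression, restricted to \<open>D_prop N R\<close> or to \<open>D_le N R\<close>, gives the two functions compared.
\<close>

definition comp_OR ::
  "nat \<Rightarrow> nat \<Rightarrow> ((nat \<Rightarrow> real) \<Rightarrow> real) \<Rightarrow> (nat \<times> nat \<Rightarrow> real) \<Rightarrow> real" where
  "comp_OR N R F y = F (\<lambda>i\<in>{1..R}. OR_fun N (block N y i))"

end

theory Submission
  imports Defs "HOL-Combinatorics.Transposition"
begin

text \<open>
  A point \<open>y\<close> of the domain of \<open>G\<^sup>p\<^sup>r\<^sup>o\<^sup>p\<close> assigns to each column \<open>j\<close> the unique block \<open>i\<close> with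
  \<open>y\<^sub>i\<^sub>j = -1\<close>. Given \<open>x\<close> with \<open>|x| \<le> N\<close>, average an approximating polynomial \<open>p\<close> over all \<open>y\<close> whose
  blocks \<open>1, \<dots>, R\<close> have the same weights as those of \<open>x\<close>; block \<open>0\<close> absorbs the slack. The value
  of the composition with OR depends only on these weights, so the average is within \<open>\<epsilon>\<close> of
  it. Write \<open>z\<^sub>i\<^sub>j = (1 - y\<^sub>i\<^sub>j) / 2\<close> and let \<open>E\<close> be the average. If \<open>T\<close> meets \<open>k\<close> columns, none of them
  \<open>j\<close>, and \<open>t\<close> of its elements lie in row \<open>i\<close>, then invariance of \<open>E\<close> under column swaps gives
  \<open>(N - k) E[z\<^sub>i\<^sub>j \<Prod>\<^sub>T z] = (c\<^sub>i - t) E[\<Prod>\<^sub>T z]\<close>, where the weight \<open>c\<^sub>i\<close> of block \<open>i\<close> is affine in \<open>x\<close>.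
  Hence \<open>E[\<Prod>\<^sub>T z]\<close> is a polynomial in \<open>x\<close> of degree at most \<open>|T|\<close>, and \<open>E[p]\<close> one of degree at most
  the degree of \<open>p\<close>.
\<close>

section \<open>Polynomial functions of bounded degree\<close>

lemma mpoly_degree_le_iff:
  "mpoly_degree p \<le> d \<longleftrightarrow> (\<forall>m\<in>Poly_Mapping.keys p. monomial_degree m \<le> d)"
  unfolding mpoly_degree_def by (subst Max_le_iff) auto

lemma mpoly_eval_superset:
  assumes "finite S" "Poly_Mapping.keys p \<subseteq> S"
  shows "mpoly_eval p x = (\<Sum>m\<in>S. Poly_Mapping.lookup p m * monomial_eval m x)"
  unfolding mpoly_eval_def using assms
  by (intro sum.mono_neutral_left) (auto simp: in_keys_iff)

lemma mpoly_eval_add: "mpoly_eval (p + q) x = mpoly_eval p x + mpoly_eval q x"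
proof -
  let ?S = "Poly_Mapping.keys p \<union> Poly_Mapping.keys q"
  have "finite ?S" by simp
  moreover have "Poly_Mapping.keys (p + q) \<subseteq> ?S" by (rule Poly_Mapping.keys_add)
  ultimately show ?thesis
    by (simp add: mpoly_eval_superset[of ?S] lookup_add distrib_right sum.distrib)
qed

lemma monomial_eval_superset:
  assumes "finite S" "Poly_Mapping.keys m \<subseteq> S"
  shows "monomial_eval m x = (\<Prod>v\<in>S. x v ^ Poly_Mapping.lookup m v)"
  unfolding monomial_eval_def using assms
  by (intro prod.mono_neutral_left) (auto simp: in_keys_iff)

lemma monomial_degree_superset:
  assumes "finite S" "Poly_Mapping.keys m \<subseteq> S"
  shows "monomial_degree m = (\<Sum>v\<in>S. Poly_Mapping.lookup m v)"
  unfolding monomial_degree_def using assms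
  by (intro sum.mono_neutral_left) (auto simp: in_keys_iff)

lemma monomial_add:
  shows monomial_eval_add: "monomial_eval (m + n) x = monomial_eval m x * monomial_eval n x"
    and monomial_degree_add: "monomial_degree (m + n) = monomial_degree m + monomial_degree n"
proof -
  let ?S = "Poly_Mapping.keys m \<union> Poly_Mapping.keys n"
  have *: "finite ?S" "Poly_Mapping.keys (m + n) \<subseteq> ?S"
    by (simp, rule Poly_Mapping.keys_add)
  show "monomial_eval (m + n) x = monomial_eval m x * monomial_eval n x"
    using * by (simp add: monomial_eval_superset[of ?S] lookup_add power_add prod.distrib)
  show "monomial_degree (m + n) = monomial_degree m + monomial_degree n"
    using * by (simp add: monomial_degree_superset[of ?S] lookup_add sum.distrib)
qed

text \<open>The degree is only bounded, not prescribed, so that sums with cancelling leading terms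
  stay in the class.\<close>

definition polyfun :: "'v set \<Rightarrow> nat \<Rightarrow> (('v \<Rightarrow> real) \<Rightarrow> real) \<Rightarrow> bool" where
  "polyfun V d f \<longleftrightarrow>
     (\<exists>p. mpoly_vars p \<subseteq> V \<and> mpoly_degree p \<le> d \<and> (\<forall>x. mpoly_eval p x = f x))"

lemma polyfun_mono: "polyfun V d f \<Longrightarrow> d \<le> e \<Longrightarrow> polyfun V e f"
  unfolding polyfun_def by (meson le_trans)

lemma polyfun_monomial:
  assumes "Poly_Mapping.keys m \<subseteq> V"
  shows "polyfun V (monomial_degree m) (\<lambda>x. c * monomial_eval m x)"
  unfolding polyfun_def
proof (intro exI conjI allI)
  let ?p = "Poly_Mapping.single m c"
  show "mpoly_vars ?p \<subseteq> V" using assms by (simp add: mpoly_vars_def)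
  show "mpoly_degree ?p \<le> monomial_degree m" by (simp add: mpoly_degree_le_iff)
  show "mpoly_eval ?p x = c * monomial_eval m x" for x
    by (subst mpoly_eval_superset[of "{m}"]) auto
qed

lemma polyfun_const:
  fixes V :: "'v set"
  shows "polyfun V d (\<lambda>x. c)"
proof -
  have "Poly_Mapping.keys (0 :: 'v monomial) \<subseteq> V" by simp
  from polyfun_monomial[OF this, of c] show ?thesis
    by (auto simp: monomial_eval_def monomial_degree_def intro: polyfun_mono)
qed

lemma polyfun_var:
  assumes "v \<in> V" shows "polyfun V (Suc 0) (\<lambda>x. x v)"
proof -
  let ?m = "Poly_Mapping.single v (Suc 0)"
  have "polyfun V (monomial_degree ?m) (\<lambda>x. 1 * monomial_eval ?m x)"
    using assms by (intro polyfun_monomial) simp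
  then show ?thesis by (simp add: monomial_eval_def monomial_degree_def)
qed

lemma polyfun_add:
  assumes "polyfun V d f" "polyfun V d g"
  shows "polyfun V d (\<lambda>x. f x + g x)"
proof -
  from assms obtain p q where
    p: "mpoly_vars p \<subseteq> V" "mpoly_degree p \<le> d" "\<And>x. mpoly_eval p x = f x" and
    q: "mpoly_vars q \<subseteq> V" "mpoly_degree q \<le> d" "\<And>x. mpoly_eval q x = g x"
    unfolding polyfun_def by blast
  have k: "Poly_Mapping.keys (p + q) \<subseteq> Poly_Mapping.keys p \<union> Poly_Mapping.keys q"
    by (rule Poly_Mapping.keys_add)
  have "mpoly_vars (p + q) \<subseteq> V" using p(1) q(1) k unfolding mpoly_vars_def by blast
  moreover have "mpoly_degree (p + q) \<le> d"
    using p(2) q(2) k unfolding mpoly_degree_le_iff by blast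
  ultimately show ?thesis
    unfolding polyfun_def using p(3) q(3) by (metis mpoly_eval_add)
qed

lemma polyfun_sum:
  assumes "\<And>i. i \<in> I \<Longrightarrow> polyfun V d (f i)"
  shows "polyfun V d (\<lambda>x. \<Sum>i\<in>I. f i x)"
  using assms
  by (induction I rule: infinite_finite_induct) (auto intro: polyfun_const polyfun_add)

lemma polyfun_mult:
  assumes "polyfun V d f" "polyfun V e g"
  shows "polyfun V (d + e) (\<lambda>x. f x * g x)"
proof -
  from assms obtain p q where
    p: "mpoly_vars p \<subseteq> V" "mpoly_degree p \<le> d" "\<And>x. mpoly_eval p x = f x" and
    q: "mpoly_vars q \<subseteq> V" "mpoly_degree q \<le> e" "\<And>x. mpoly_eval q x = g x"
    unfolding polyfun_def by blast
  let ?c = "\<lambda>m n. Poly_Mapping.lookup p m * Poly_Mapping.lookup q n"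
  have eq: "f x * g x = (\<Sum>m\<in>Poly_Mapping.keys p. \<Sum>n\<in>Poly_Mapping.keys q.
      ?c m n * monomial_eval (m + n) x)" for x
    unfolding p(3)[symmetric] q(3)[symmetric] mpoly_eval_def sum_product monomial_eval_add
    by (simp add: mult_ac)
  have "polyfun V (d + e) (\<lambda>x. ?c m n * monomial_eval (m + n) x)"
    if "m \<in> Poly_Mapping.keys p" "n \<in> Poly_Mapping.keys q" for m n
  proof (rule polyfun_mono)
    have "Poly_Mapping.keys (m + n) \<subseteq> Poly_Mapping.keys m \<union> Poly_Mapping.keys n"
      by (rule Poly_Mapping.keys_add)
    then show "polyfun V (monomial_degree (m + n)) (\<lambda>x. ?c m n * monomial_eval (m + n) x)"
      using p(1) q(1) that unfolding mpoly_vars_def by (intro polyfun_monomial) blast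
    show "monomial_degree (m + n) \<le> d + e"
      using p(2) q(2) that by (simp add: mpoly_degree_le_iff monomial_degree_add add_mono)
  qed
  then show ?thesis unfolding eq by (intro polyfun_sum)
qed

lemma polyfun_cmult: "polyfun V d f \<Longrightarrow> polyfun V d (\<lambda>x. c * f x)"
  using polyfun_mult[OF polyfun_const[of V 0 c]] by simp

lemma polyfun_prod:
  assumes "\<And>i. i \<in> I \<Longrightarrow> polyfun V d (f i)"
  shows "polyfun V (card I * d) (\<lambda>x. \<Prod>i\<in>I. f i x)"
  using assms
  by (induction I rule: infinite_finite_induct) (auto intro: polyfun_const polyfun_mult)

text \<open>Lagrange interpolation on the cube. It will show that the minimum defining
  \<open>approx_deg\<close> is attained.\<close>

lemma polyfun_interpolation:
  fixes h :: "('v \<Rightarrow> real) \<Rightarrow> real"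
  assumes "finite V" "X \<subseteq> sign_cube V"
  obtains d f where "polyfun V d f" "\<And>x. x \<in> X \<Longrightarrow> f x = h x"
proof
  \<comment> \<open>Each factor is \<open>(1 + a v * x v) / 2\<close>: for two signs it is 1 if they
    agree and 0 otherwise, so the product tests whether the points are equal.\<close>
  let ?L = "\<lambda>a x. \<Prod>v\<in>V. 1/2 + (a v / 2) * x v"
  let ?f = "\<lambda>x. \<Sum>a\<in>X. h a * ?L a x"
  show "polyfun V (card V * Suc 0) ?f"
    by (intro polyfun_sum polyfun_cmult polyfun_prod polyfun_add polyfun_const polyfun_var)
  have "finite X"
    using assms finite_subset[of X] by (auto simp: sign_cube_def intro!: finite_PiE)
  have L: "?L a x = (if a = x then 1 else 0)" if "a \<in> X" "x \<in> X" for a x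
  proof -
    have ax: "a \<in> V \<rightarrow>\<^sub>E {-1, 1}" "x \<in> V \<rightarrow>\<^sub>E {-1, 1}"
      using that assms(2) by (auto simp: sign_cube_def)
    show ?thesis
    proof (cases "a = x")
      case True
      then show ?thesis using ax by (auto intro!: prod.neutral dest!: PiE_mem)
    next
      case False
      \<comment> \<open>Extensionality matters: distinct points of the cube differ at a coordinate
        inside \<open>V\<close>.\<close>
      then obtain v where v: "v \<in> V" "a v \<noteq> x v" using ax PiE_ext by blast
      then have "1/2 + (a v / 2) * x v = 0"
        using PiE_mem[OF ax(1) v(1)] PiE_mem[OF ax(2) v(1)] by auto
      then have "?L a x = 0" using v(1) assms(1) by (auto intro!: prod_zero)
      with False show ?thesis by simp
    qed
  qed
  show "?f x = h x" if "x \<in> X" for x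
  proof -
    have "?f x = (\<Sum>a\<in>X. if a = x then h a else 0)"
      using that L by (intro sum.cong) (auto simp del: prod_zero_iff)
    with \<open>finite X\<close> that show ?thesis by simp
  qed
qed

section \<open>Averaging over the points with given block weights\<close>

definition ind :: "('v \<Rightarrow> real) \<Rightarrow> 'v \<Rightarrow> real" where
  "ind y v = (1 - y v) / 2"

text \<open>On sign vectors these sums are the block weights, written so as to be affine in the
  entries. Block 0 is left free because its weight is then forced.\<close>

definition fiber :: "nat \<Rightarrow> nat \<Rightarrow> (nat \<times> nat \<Rightarrow> real) \<Rightarrow> (nat \<times> nat \<Rightarrow> real) set" where
  "fiber N R x = {y \<in> D_prop N R.
     \<forall>i\<in>{1..R}. (\<Sum>j\<in>{1..N}. ind y (i, j)) = (\<Sum>j\<in>{1..N}. ind x (i, j))}"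

text \<open>On an empty fiber the quotient is 0, so averages of constants are right only where the
  fiber is nonempty, in particular on \<open>D_le N R\<close>.\<close>

definition avg :: "nat \<Rightarrow> nat \<Rightarrow> ((nat \<times> nat \<Rightarrow> real) \<Rightarrow> real) \<Rightarrow> (nat \<times> nat \<Rightarrow> real) \<Rightarrow> real" where
  "avg N R g x = (\<Sum>y\<in>fiber N R x. g y) / real (card (fiber N R x))"

text \<open>The common weight of block \<open>i\<close> over the fiber of \<open>x\<close>, as a
  real affine function of \<open>x\<close>; block 0 gets what the other blocks leave of the
  \<open>N\<close> columns.\<close>

definition block_size :: "nat \<Rightarrow> nat \<Rightarrow> nat \<Rightarrow> (nat \<times> nat \<Rightarrow> real) \<Rightarrow> real" where
  "block_size N R i x =
     (if i = 0 then real N - (\<Sum>i\<in>{1..R}. \<Sum>j\<in>{1..N}. ind x (i, j))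
      else (\<Sum>j\<in>{1..N}. ind x (i, j)))"

lemma finite_D_prop: "finite (D_prop N R)"
  unfolding D_prop_def sign_cube_def by (intro finite_subset[OF Collect_restrict] finite_PiE) auto

lemma finite_fiber: "finite (fiber N R x)"
  unfolding fiber_def using finite_D_prop by simp

text \<open>Entries other than the unique -1 equal 1 because \<open>y\<close> is a sign vector, so
  under \<open>ind\<close> every column is a unit vector.\<close>

lemma ind_D_prop:
  assumes "y \<in> D_prop N R" "j \<in> {1..N}"
  obtains i where "i \<in> {0..R}" "\<And>i'. i' \<in> {0..R} \<Longrightarrow> ind y (i', j) = (if i' = i then 1 else 0)"
proof -
  from assms obtain i where i: "i \<in> {0..R}" "y (i, j) = -1"
    and u: "\<And>i'. i' \<in> {0..R} \<Longrightarrow> y (i', j) = -1 \<Longrightarrow> i' = i"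
    unfolding D_prop_def by blast
  have pm: "y (i', j) \<in> {-1, 1}" if "i' \<in> {0..R}" for i'
    using assms that unfolding D_prop_def sign_cube_def by (auto dest!: PiE_mem)
  have "ind y (i', j) = (if i' = i then 1 else 0)" if "i' \<in> {0..R}" for i'
  proof (cases "i' = i")
    case False
    then have "y (i', j) = 1" using pm[OF that] u[OF that] by blast
    with False show ?thesis by (simp add: ind_def)
  qed (simp add: ind_def i(2))
  with i(1) show thesis by (rule that)
qed

text \<open>For block 0, double counting: each column has total 1, so all blocks together have
  weight \<open>N\<close>.\<close>

lemma sum_ind_fiber:
  assumes "y \<in> fiber N R x" "i \<in> {0..R}"
  shows "(\<Sum>j\<in>{1..N}. ind y (i, j)) = block_size N R i x"
proof (cases "i = 0")
  case True
  have y: "y \<in> D_prop N R" using assms(1) by (simp add: fiber_def)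
  have one: "(\<Sum>i\<in>{0..R}. ind y (i, j)) = 1" if j: "j \<in> {1..N}" for j
    by (rule ind_D_prop[OF y j]) simp
  have "real N = (\<Sum>j\<in>{1..N}. \<Sum>i\<in>{0..R}. ind y (i, j))"
    using one by simp
  also have "\<dots> = (\<Sum>i\<in>{0..R}. \<Sum>j\<in>{1..N}. ind y (i, j))"
    by (rule sum.swap)
  also have "\<dots> = (\<Sum>j\<in>{1..N}. ind y (0, j)) + (\<Sum>i\<in>{1..R}. \<Sum>j\<in>{1..N}. ind y (i, j))"
    by (simp add: sum.atLeast_Suc_atMost)
  also have "(\<Sum>i\<in>{1..R}. \<Sum>j\<in>{1..N}. ind y (i, j)) = (\<Sum>i\<in>{1..R}. \<Sum>j\<in>{1..N}. ind x (i, j))"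
    by (rule sum.cong[OF refl]) (use assms(1) in \<open>simp add: fiber_def\<close>)
  finally show ?thesis using True by (simp add: block_size_def)
next
  case False
  then show ?thesis using assms by (auto simp: block_size_def fiber_def)
qed

lemma polyfun_ind: "v \<in> V \<Longrightarrow> polyfun V (Suc 0) (\<lambda>x. ind x v)"
  using polyfun_add[OF polyfun_const[of V "Suc 0" "1/2"] polyfun_cmult[OF polyfun_var[of v V], of "-1/2"]]
  by (simp add: ind_def diff_divide_distrib)

lemma polyfun_block_size:
  assumes "i \<in> {0..R}"
  shows "polyfun ({1..R} \<times> {1..N}) (Suc 0) (block_size N R i)"
proof (cases "i = 0")
  case True
  have "polyfun ({1..R} \<times> {1..N}) (Suc 0)
    (\<lambda>x. real N + (-1) * (\<Sum>i\<in>{1..R}. \<Sum>j\<in>{1..N}. ind x (i, j)))"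
    by (intro polyfun_add polyfun_const polyfun_cmult polyfun_sum polyfun_ind) auto
  with True show ?thesis by (simp add: block_size_def[abs_def])
next
  case False
  then have "polyfun ({1..R} \<times> {1..N}) (Suc 0) (\<lambda>x. \<Sum>j\<in>{1..N}. ind x (i, j))"
    using assms by (intro polyfun_sum polyfun_ind) auto
  with False show ?thesis by (simp add: block_size_def[abs_def])
qed

text \<open>The bound on the weight of \<open>x\<close> enters here: the -1 entries of
  \<open>x\<close> inject into the columns, each column hit goes to the block of its entry, and the
  others go to block 0.\<close>

lemma fiber_nonempty:
  assumes "x \<in> D_le N R"
  shows "fiber N R x \<noteq> {}"
proof -
  define P where "P = {v \<in> {1..R} \<times> {1..N}. x v = -1}"
  have "finite P" by (simp add: P_def)
  moreover have "card P \<le> card {1..N}"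
    using assms by (simp add: P_def D_le_def weight_def)
  ultimately obtain e where e: "e ` P \<subseteq> {1..N}" "inj_on e P"
    using card_le_inj[of P "{1..N}"] by auto
  define f where "f j = (if j \<in> e ` P then fst (inv_into P e j) else 0)" for j
  have fe: "f (e v) = fst v" if "v \<in> P" for v
    using that e(2) by (simp add: f_def)
  have fR: "f j \<in> {0..R}" for j
  proof (cases "j \<in> e ` P")
    case True
    then obtain v where "v \<in> P" "j = e v" by blast
    then show ?thesis using fe by (auto simp: P_def)
  qed (simp add: f_def)
  \<comment> \<open>Only block 0 can receive a column outside the image of \<open>e\<close>.\<close>
  have f_pos: "j \<in> e ` {v \<in> P. fst v = i}" if "f j = i" "i \<noteq> 0" for i j
  proof -
    have "j \<in> e ` P" using that by (auto simp: f_def split: if_splits)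
    then show ?thesis using fe that by auto
  qed
  define y where "y = (\<lambda>v\<in>{0..R} \<times> {1..N}. if f (snd v) = fst v then - 1 else (1::real))"
  have yv: "y (i, j) = (if f j = i then -1 else 1)" if "i \<in> {0..R}" "j \<in> {1..N}" for i j
    using that by (simp add: y_def)
  have "y \<in> sign_cube ({0..R} \<times> {1..N})"
    by (auto simp: y_def sign_cube_def)
  moreover have "\<exists>!i. i \<in> {0..R} \<and> y (i, j) = -1" if "j \<in> {1..N}" for j
    using that fR[of j] by (intro ex1I[of _ "f j"]) (auto simp: yv split: if_splits)
  ultimately have "y \<in> D_prop N R" by (simp add: D_prop_def)
  moreover have "(\<Sum>j\<in>{1..N}. ind y (i, j)) = (\<Sum>j\<in>{1..N}. ind x (i, j))" if i: "i \<in> {1..R}" for i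
  proof -
    have x: "x (i, j) \<in> {-1, 1}" if "j \<in> {1..N}" for j
      using assms i that unfolding D_le_def sign_cube_def by (auto dest!: PiE_mem)
    have "(\<Sum>j\<in>{1..N}. ind y (i, j)) = (\<Sum>j\<in>{1..N}. if f j = i then 1 else 0)"
      using i by (intro sum.cong) (auto simp: ind_def yv)
    also have "\<dots> = real (card {j \<in> {1..N}. f j = i})"
      by (simp add: sum.If_cases Int_def)
    \<comment> \<open>The columns given to block \<open>i\<close> are the images of the -1 entries
      of \<open>x\<close> in block \<open>i\<close>, and \<open>e\<close> is injective.\<close>
    also have "{j \<in> {1..N}. f j = i} = e ` {v \<in> P. fst v = i}"
      using e(1) fe f_pos[of _ i] i by auto
    also have "card \<dots> = card {v \<in> P. fst v = i}"
      using e(2) by (intro card_image) (auto simp: inj_on_def)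
    also have "{v \<in> P. fst v = i} = Pair i ` {j \<in> {1..N}. x (i, j) = -1}"
      using i by (auto simp: P_def)
    also have "card \<dots> = card {j \<in> {1..N}. x (i, j) = -1}"
      by (intro card_image) (auto simp: inj_on_def)
    also have "real \<dots> = (\<Sum>j\<in>{1..N}. if x (i, j) = -1 then 1 else 0)"
      by (simp add: sum.If_cases Int_def)
    also have "\<dots> = (\<Sum>j\<in>{1..N}. ind x (i, j))"
      using x by (intro sum.cong) (auto simp: ind_def)
    finally show ?thesis .
  qed
  ultimately have "y \<in> fiber N R x" by (simp add: fiber_def)
  then show ?thesis by blast
qed

text \<open>OR of a block depends only on whether its weight is zero, and the fiber fixes the
  weights of the blocks that \<open>F\<close> sees.\<close>

lemma comp_OR_fiber:
  assumes "x \<in> D_le N R" "y \<in> fiber N R x"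
  shows "comp_OR N R F y = comp_OR N R F x"
proof -
  \<comment> \<open>Stated for any \<open>w\<close> with signs in row \<open>i\<close>, to serve
    both \<open>y\<close> and \<open>x\<close>, which lie in different cubes.\<close>
  have OR: "OR_fun N (block N w i) = (if (\<Sum>j\<in>{1..N}. ind w (i, j)) = 0 then 1 else -1)"
    if "\<And>j. j \<in> {1..N} \<Longrightarrow> w (i, j) \<in> {-1, 1}" for w i
  proof -
    have nn: "0 \<le> ind w (i, j)" if "j \<in> {1..N}" for j
      using \<open>\<And>j. j \<in> {1..N} \<Longrightarrow> w (i, j) \<in> {-1, 1}\<close>[OF that] by (auto simp: ind_def)
    have "(\<Sum>j\<in>{1..N}. ind w (i, j)) = 0 \<longleftrightarrow> (\<forall>j\<in>{1..N}. ind w (i, j) = 0)"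
      using nn by (intro sum_nonneg_eq_0_iff) auto
    also have "\<dots> \<longleftrightarrow> \<not> (\<exists>j\<in>{1..N}. w (i, j) = -1)"
    proof -
      have "ind w (i, j) = 0 \<longleftrightarrow> w (i, j) \<noteq> -1" if "j \<in> {1..N}" for j
        using \<open>\<And>j. j \<in> {1..N} \<Longrightarrow> w (i, j) \<in> {-1, 1}\<close>[OF that] by (auto simp: ind_def)
      then show ?thesis by blast
    qed
    finally show ?thesis by (simp add: OR_fun_def block_def)
  qed
  have "OR_fun N (block N y i) = OR_fun N (block N x i)" if i: "i \<in> {1..R}" for i
  proof -
    have yx: "y (i, j) \<in> {-1, 1}" "x (i, j) \<in> {-1, 1}" if "j \<in> {1..N}" for j
      using assms i that
      unfolding D_le_def fiber_def D_prop_def sign_cube_def by (auto dest!: PiE_mem)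
    have "(\<Sum>j\<in>{1..N}. ind y (i, j)) = (\<Sum>j\<in>{1..N}. ind x (i, j))"
      using assms(2) i by (simp add: fiber_def)
    then show ?thesis using OR[of y i, OF yx(1)] OR[of x i, OF yx(2)] by simp
  qed
  then have "(\<lambda>i\<in>{1..R}. OR_fun N (block N y i)) = (\<lambda>i\<in>{1..R}. OR_fun N (block N x i))"
    by (intro restrict_ext)
  then show ?thesis unfolding comp_OR_def by (rule arg_cong)
qed

section \<open>Column symmetry and the recursion for averages of products\<close>

definition swap_cols :: "nat \<Rightarrow> nat \<Rightarrow> (nat \<times> nat \<Rightarrow> real) \<Rightarrow> nat \<times> nat \<Rightarrow> real" where
  "swap_cols a b y = (\<lambda>(i, j). y (i, Transposition.transpose a b j))"

lemma swap_cols_involutory: "swap_cols a b (swap_cols a b y) = y"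
  by (auto simp: swap_cols_def)

text \<open>Columns move as wholes, so each still has a unique -1, and every row sum is merely
  reordered.\<close>

lemma swap_cols_fiber:
  assumes "a \<in> {1..N}" "b \<in> {1..N}" "y \<in> fiber N R x"
  shows "swap_cols a b y \<in> fiber N R x"
proof -
  let ?t = "Transposition.transpose a b"
  have t: "?t j \<in> {1..N} \<longleftrightarrow> j \<in> {1..N}" for j
    using assms(1,2) by (auto simp: Transposition.transpose_def)
  have bij: "bij_betw ?t {1..N} {1..N}"
    by (intro bij_betw_byWitness[where f' = ?t]) (auto simp: t simp del: atLeastAtMost_iff One_nat_def)
  have y: "y \<in> sign_cube ({0..R} \<times> {1..N})" "\<forall>j\<in>{1..N}. \<exists>!i. i \<in> {0..R} \<and> y (i, j) = -1"
    and s: "\<forall>i\<in>{1..R}. (\<Sum>j\<in>{1..N}. ind y (i, j)) = (\<Sum>j\<in>{1..N}. ind x (i, j))"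
    using assms(3) by (auto simp: fiber_def D_prop_def)
  have "swap_cols a b y \<in> sign_cube ({0..R} \<times> {1..N})"
    using y(1) t unfolding sign_cube_def swap_cols_def PiE_iff extensional_def
    by (auto simp del: atLeastAtMost_iff)
  moreover have "\<forall>j\<in>{1..N}. \<exists>!i. i \<in> {0..R} \<and> swap_cols a b y (i, j) = -1"
    using y(2) t by (simp add: swap_cols_def del: atLeastAtMost_iff)
  moreover have "(\<Sum>j\<in>{1..N}. ind (swap_cols a b y) (i, j)) = (\<Sum>j\<in>{1..N}. ind y (i, j))" for i
    using sum.reindex_bij_betw[OF bij, of "\<lambda>j. ind y (i, j)"]
    by (simp add: ind_def swap_cols_def)
  ultimately show ?thesis using s by (simp add: fiber_def D_prop_def)
qed

text \<open>The swap is an involution of the fiber, so it only reindexes the sum.\<close>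

lemma avg_swap_cols:
  assumes "a \<in> {1..N}" "b \<in> {1..N}"
  shows "avg N R (\<lambda>y. g (swap_cols a b y)) x = avg N R g x"
proof -
  have "bij_betw (swap_cols a b) (fiber N R x) (fiber N R x)"
    using swap_cols_fiber[OF assms]
    by (intro bij_betw_byWitness[where f' = "swap_cols a b"]) (auto simp: swap_cols_involutory)
  then show ?thesis
    unfolding avg_def by (simp add: sum.reindex_bij_betw)
qed

lemma avg_cong: "(\<And>y. y \<in> fiber N R x \<Longrightarrow> g y = h y) \<Longrightarrow> avg N R g x = avg N R h x"
  unfolding avg_def by (simp cong: sum.cong)

lemma avg_add: "avg N R (\<lambda>y. g y + h y) x = avg N R g x + avg N R h x"
  by (simp add: avg_def sum.distrib add_divide_distrib)

lemma avg_cmult: "avg N R (\<lambda>y. c * g y) x = c * avg N R g x"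
  by (simp add: avg_def sum_distrib_left)

lemma avg_sum: "avg N R (\<lambda>y. \<Sum>i\<in>I. g i y) x = (\<Sum>i\<in>I. avg N R (g i) x)"
  unfolding avg_def sum_divide_distrib by (rule sum.swap)

lemma avg_one: "x \<in> D_le N R \<Longrightarrow> avg N R (\<lambda>y. 1) x = 1"
  using fiber_nonempty[of x N R] finite_fiber[of N R x] by (simp add: avg_def card_eq_0_iff)

text \<open>Sum the average with the extra factor over all columns not met by \<open>T\<close>. By
  symmetry the summands agree. Pointwise, where the product over \<open>T\<close> is nonzero, the -1
  entries of row \<open>i\<close> in the columns of \<open>T\<close> are exactly the cells of
  \<open>T\<close> in that row; the remaining ones lie in the free columns.\<close>

lemma avg_prod_ind_insert:
  assumes T: "T \<subseteq> {0..R} \<times> {1..N}" and i: "i \<in> {0..R}" and j: "j \<in> {1..N}" "j \<notin> snd ` T"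
  shows "real (card ({1..N} - snd ` T)) * avg N R (\<lambda>y. \<Prod>v\<in>insert (i, j) T. ind y v) x
       = (block_size N R i x - real (card {j. (i, j) \<in> T})) * avg N R (\<lambda>y. \<Prod>v\<in>T. ind y v) x"
proof -
  let ?Z = "\<lambda>y. \<Prod>v\<in>T. ind y v" and ?J = "snd ` T"
  have fin: "finite T" using T by (rule finite_subset) simp
  have J: "?J \<subseteq> {1..N}" using T by auto
  have sym: "avg N R (\<lambda>y. ind y (i, j') * ?Z y) x = avg N R (\<lambda>y. ind y (i, j) * ?Z y) x"
    if j': "j' \<in> {1..N} - ?J" for j'
  proof -
    \<comment> \<open>Neither swapped column meets \<open>T\<close>, so the product over
      \<open>T\<close> does not change.\<close>
    have "ind (swap_cols j j' y) v = ind y v" if "v \<in> T" for y v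
    proof -
      have "snd v \<noteq> j" "snd v \<noteq> j'" using that j(2) j' by auto
      then show ?thesis by (cases v) (simp add: ind_def swap_cols_def)
    qed
    then have "?Z (swap_cols j j' y) = ?Z y" for y
      by (intro prod.cong) auto
    moreover have "ind (swap_cols j j' y) (i, j) = ind y (i, j')" for y
      by (simp add: ind_def swap_cols_def)
    ultimately show ?thesis
      using avg_swap_cols[of j N j' R "\<lambda>y. ind y (i, j) * ?Z y" x] j(1) j' by simp
  qed
  have "real (card ({1..N} - ?J)) * avg N R (\<lambda>y. \<Prod>v\<in>insert (i, j) T. ind y v) x
      = real (card ({1..N} - ?J)) * avg N R (\<lambda>y. ind y (i, j) * ?Z y) x"
    using fin j(2) by (subst prod.insert) force+
  also have "\<dots> = (\<Sum>j'\<in>{1..N} - ?J. avg N R (\<lambda>y. ind y (i, j') * ?Z y) x)"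
    using sym by simp
  also have "\<dots> = avg N R (\<lambda>y. \<Sum>j'\<in>{1..N} - ?J. ind y (i, j') * ?Z y) x"
    by (rule avg_sum[symmetric])
  also have "\<dots> = avg N R (\<lambda>y. (block_size N R i x - real (card {j. (i, j) \<in> T})) * ?Z y) x"
  proof (rule avg_cong)
    fix y assume y: "y \<in> fiber N R x"
    have yD: "y \<in> D_prop N R" using y by (simp add: fiber_def)
    show "(\<Sum>j'\<in>{1..N} - ?J. ind y (i, j') * ?Z y)
      = (block_size N R i x - real (card {j. (i, j) \<in> T})) * ?Z y"
    proof (cases "?Z y = 0")
      case False
      \<comment> \<open>A nonzero product puts -1 in every cell of \<open>T\<close>. A column has
        only one -1, so in a column met by \<open>T\<close> it is at the cell of
        \<open>T\<close>.\<close>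
      have ind_J: "ind y (i, j') = (if (i, j') \<in> T then 1 else 0)" if j': "j' \<in> ?J" for j'
      proof -
        obtain i0 where i0: "\<And>i'. i' \<in> {0..R} \<Longrightarrow> ind y (i', j') = (if i' = i0 then 1 else 0)"
          using subsetD[OF J j'] by (rule ind_D_prop[OF yD]) blast
        have nz: "ind y v \<noteq> 0" if "v \<in> T" for v
          using False that fin by auto
        have T_i0: "i' = i0" if "(i', j') \<in> T" for i'
          using nz[OF that] i0[of i'] that T by (auto split: if_splits)
        from j' obtain i' where "(i', j') \<in> T" by auto
        with T_i0 have "(i, j') \<in> T \<longleftrightarrow> i = i0" by blast
        with i0[OF i] show ?thesis by simp
      qed
      have "(\<Sum>j'\<in>?J. ind y (i, j')) = (\<Sum>j'\<in>?J. if (i, j') \<in> T then 1 else 0)"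
        using ind_J by (intro sum.cong) auto
      also have "\<dots> = real (card (?J \<inter> {j. (i, j) \<in> T}))"
        using fin by (simp add: sum.If_cases)
      also have "?J \<inter> {j. (i, j) \<in> T} = {j. (i, j) \<in> T}" by force
      finally have "(\<Sum>j'\<in>{1..N} - ?J. ind y (i, j'))
        = block_size N R i x - real (card {j. (i, j) \<in> T})"
        using J sum_ind_fiber[OF y i] by (simp add: sum_diff)
      then show ?thesis by (simp add: sum_distrib_right[symmetric])
    qed simp
  qed
  also have "\<dots> = (block_size N R i x - real (card {j. (i, j) \<in> T})) * avg N R ?Z x"
    by (rule avg_cmult)
  finally show ?thesis .
qed

section \<open>The average of a polynomial is a polynomial\<close>

text \<open>The polynomial uses only the variables of blocks 1 to \<open>R\<close>: averaging
  eliminates block 0.\<close>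

definition avg_poly :: "nat \<Rightarrow> nat \<Rightarrow> nat \<Rightarrow> ((nat \<times> nat \<Rightarrow> real) \<Rightarrow> real) \<Rightarrow> bool" where
  "avg_poly N R d g \<longleftrightarrow>
     (\<exists>q. polyfun ({1..R} \<times> {1..N}) d q \<and> (\<forall>x\<in>D_le N R. avg N R g x = q x))"

lemma avg_poly_mono: "avg_poly N R d g \<Longrightarrow> d \<le> e \<Longrightarrow> avg_poly N R e g"
  unfolding avg_poly_def by (meson polyfun_mono)

lemma avg_poly_cong:
  assumes "avg_poly N R d g" "\<And>y. y \<in> D_prop N R \<Longrightarrow> h y = g y"
  shows "avg_poly N R d h"
proof -
  have "avg N R h x = avg N R g x" for x
    by (rule avg_cong) (auto simp: fiber_def assms(2))
  with assms(1) show ?thesis unfolding avg_poly_def by simp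
qed

lemma avg_poly_cmult: "avg_poly N R d g \<Longrightarrow> avg_poly N R d (\<lambda>y. c * g y)"
  unfolding avg_poly_def by (metis (no_types, lifting) avg_cmult polyfun_cmult)

lemma avg_poly_add:
  "avg_poly N R d g \<Longrightarrow> avg_poly N R d h \<Longrightarrow> avg_poly N R d (\<lambda>y. g y + h y)"
  unfolding avg_poly_def
  by (elim exE conjE, rule exI, rule conjI, erule (1) polyfun_add) (simp add: avg_add)

lemma avg_poly_const: "avg_poly N R d (\<lambda>y. c)"
proof -
  have "avg N R (\<lambda>y. c) x = c" if "x \<in> D_le N R" for x
    using avg_cmult[of N R c "\<lambda>y. 1" x] avg_one[OF that] by simp
  then show ?thesis unfolding avg_poly_def using polyfun_const by blast
qed

lemma avg_poly_sum:
  assumes "\<And>i. i \<in> I \<Longrightarrow> avg_poly N R d (g i)"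
  shows "avg_poly N R d (\<lambda>y. \<Sum>i\<in>I. g i y)"
  using assms
  by (induction I rule: infinite_finite_induct) (auto intro: avg_poly_const avg_poly_add)

text \<open>Induction on \<open>T\<close>: a cell in a new column multiplies the average by an
  affine function of \<open>x\<close>, raising the degree by at most one; a second cell in an
  occupied column makes the product vanish.\<close>

lemma avg_poly_prod_ind:
  assumes "T \<subseteq> {0..R} \<times> {1..N}"
  shows "avg_poly N R (card T) (\<lambda>y. \<Prod>v\<in>T. ind y v)"
proof -
  have "finite T" using assms by (rule finite_subset) simp
  then show ?thesis using assms
  proof (induction T rule: finite_induct)
    case empty
    then show ?case by (simp add: avg_poly_const)
  next
    case (insert v T)
    obtain i j where v: "v = (i, j)" by force
    have ij: "i \<in> {0..R}" "j \<in> {1..N}" and T: "T \<subseteq> {0..R} \<times> {1..N}"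
      using insert.prems v by auto
    show ?case
    proof (cases "j \<in> snd ` T")
      case True
      then obtain i' where i': "(i', j) \<in> T" by auto
      have "i' \<noteq> i" using i' insert.hyps v by auto
      show ?thesis
      proof (rule avg_poly_cong[OF avg_poly_const[of _ _ _ 0]])
        fix y assume "y \<in> D_prop N R"
        then obtain i0 where i0:
          "\<And>i'. i' \<in> {0..R} \<Longrightarrow> ind y (i', j) = (if i' = i0 then 1 else 0)"
          using ij(2) by (rule ind_D_prop) blast
        have "ind y (i, j) = 0 \<or> ind y (i', j) = 0"
          using i0[of i] i0[of i'] ij(1) i' T \<open>i' \<noteq> i\<close> by (auto split: if_splits)
        then show "(\<Prod>v\<in>insert v T. ind y v) = 0"
          using i' v insert.hyps(1) by auto
      qed
    next
      case False
      let ?k = "real (card ({1..N} - snd ` T))" and ?t = "real (card {j. (i, j) \<in> T})"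
      obtain q where q: "polyfun ({1..R} \<times> {1..N}) (card T) q"
        "\<And>x. x \<in> D_le N R \<Longrightarrow> avg N R (\<lambda>y. \<Prod>v\<in>T. ind y v) x = q x"
        using insert.IH[OF T] unfolding avg_poly_def by blast
      \<comment> \<open>Column \<open>j\<close> itself is free, so the recursion can be divided by
        the number of free columns.\<close>
      have "?k \<noteq> 0" using False ij(2) by auto
      moreover have "?k * avg N R (\<lambda>y. \<Prod>v\<in>insert v T. ind y v) x
        = (block_size N R i x - ?t) * q x" if "x \<in> D_le N R" for x
        using avg_prod_ind_insert[OF T ij False, of x] q(2)[OF that] v by simp
      ultimately have eq: "avg N R (\<lambda>y. \<Prod>v\<in>insert v T. ind y v) x
        = (1 / ?k) * ((block_size N R i x + - ?t) * q x)" if "x \<in> D_le N R" for x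
        using that by (simp add: field_simps)
      have "polyfun ({1..R} \<times> {1..N}) (Suc 0 + card T)
        (\<lambda>x. (1 / ?k) * ((block_size N R i x + - ?t) * q x))"
        by (intro polyfun_cmult polyfun_mult polyfun_add polyfun_const polyfun_block_size q(1) ij(1))
      then show ?thesis
        unfolding avg_poly_def using eq insert.hyps by auto
    qed
  qed
qed

text \<open>
  The factor \<open>\<Prod>\<^sub>T z\<close> makes the property stable under multiplication by a coordinate, because
  \<open>y\<^sub>v \<Prod>\<^sub>T z = \<Prod>\<^sub>T z - 2 \<Prod>\<^bsub>T \<union> {v}\<^esub> z\<close> on the 0/1-valued \<open>z\<close>.
\<close>

definition avg_poly_ind :: "nat \<Rightarrow> nat \<Rightarrow> nat \<Rightarrow> ((nat \<times> nat \<Rightarrow> real) \<Rightarrow> real) \<Rightarrow> bool" where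
  "avg_poly_ind N R d g \<longleftrightarrow>
     (\<forall>T \<subseteq> {0..R} \<times> {1..N}. avg_poly N R (d + card T) (\<lambda>y. (\<Prod>v\<in>T. ind y v) * g y))"

lemma avg_poly_ind_mult_var:
  assumes g: "avg_poly_ind N R d g" and v: "v \<in> {0..R} \<times> {1..N}"
  shows "avg_poly_ind N R (Suc d) (\<lambda>y. y v * g y)"
  unfolding avg_poly_ind_def
proof (intro allI impI)
  fix T assume T: "T \<subseteq> {0..R} \<times> {1..N}"
  then have fin: "finite T" by (rule finite_subset) simp
  let ?Z = "\<lambda>T y. \<Prod>v\<in>T. ind y v"
  have "avg_poly N R (d + card T) (\<lambda>y. ?Z T y * g y)"
    using g T unfolding avg_poly_ind_def by blast
  then have 1: "avg_poly N R (Suc d + card T) (\<lambda>y. ?Z T y * g y)"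
    by (rule avg_poly_mono) simp
  have "avg_poly N R (d + card (insert v T)) (\<lambda>y. ?Z (insert v T) y * g y)"
    using g T v unfolding avg_poly_ind_def by (meson insert_subset)
  then have 2: "avg_poly N R (Suc d + card T) (\<lambda>y. ?Z (insert v T) y * g y)"
    \<comment> \<open>Inserting \<open>v\<close> enlarges \<open>T\<close> by at most one cell,
      which the increase from \<open>d\<close> to \<open>Suc d\<close> pays for.\<close>
    by (rule avg_poly_mono) (use fin in \<open>simp add: card_insert_if\<close>)
  show "avg_poly N R (Suc d + card T) (\<lambda>y. ?Z T y * (y v * g y))"
  proof (rule avg_poly_cong[OF avg_poly_add[OF 1 avg_poly_cmult[OF 2, of "-2"]]])
    fix y assume "y \<in> D_prop N R"
    then have "y v \<in> {-1, 1}"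
      using v unfolding D_prop_def sign_cube_def by (auto dest!: PiE_mem)
    then have iv: "ind y v * ind y v = ind y v" by (auto simp: ind_def)
    have "?Z (insert v T) y = ind y v * ?Z T y"
    \<comment> \<open>If \<open>v\<close> is already in \<open>T\<close>, the extra factor is
      absorbed because \<open>ind y v\<close> is idempotent.\<close>
    proof (cases "v \<in> T")
      case True
      then have "?Z T y = ind y v * ?Z (T - {v}) y" using fin by (simp add: prod.remove)
      then show ?thesis using True iv by (simp add: insert_absorb mult.assoc[symmetric])
    qed (simp add: fin)
    moreover have "y v = 1 - 2 * ind y v" by (simp add: ind_def field_simps)
    ultimately show "?Z T y * (y v * g y) = ?Z T y * g y + -2 * (?Z (insert v T) y * g y)"
      by (simp only:) (simp add: algebra_simps)
  qed
qed

lemma avg_poly_ind_mult_power: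
  assumes "avg_poly_ind N R d g" "v \<in> {0..R} \<times> {1..N}"
  shows "avg_poly_ind N R (k + d) (\<lambda>y. y v ^ k * g y)"
proof (induction k)
  case (Suc k)
  from avg_poly_ind_mult_var[OF Suc assms(2)] show ?case by (simp add: mult.assoc)
qed (use assms in simp)

lemma avg_poly_ind_prod_power:
  assumes "finite S" "S \<subseteq> {0..R} \<times> {1..N}"
  shows "avg_poly_ind N R (\<Sum>v\<in>S. e v) (\<lambda>y. \<Prod>v\<in>S. y v ^ e v)"
  using assms
proof (induction S rule: finite_induct)
  case empty
  \<comment> \<open>For the constant 1 the property is the degree bound for products of
    \<open>ind\<close>.\<close>
  then show ?case by (simp add: avg_poly_ind_def avg_poly_prod_ind)
next
  case (insert v S)
  then show ?case using avg_poly_ind_mult_power[of N R "sum e S" _ v "e v"] by simp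
qed

lemma avg_poly_mpoly_eval:
  assumes "mpoly_vars p \<subseteq> {0..R} \<times> {1..N}"
  shows "avg_poly N R (mpoly_degree p) (mpoly_eval p)"
proof -
  have "avg_poly N R (mpoly_degree p) (monomial_eval m)" if m: "m \<in> Poly_Mapping.keys p" for m
  proof (rule avg_poly_mono)
    have "Poly_Mapping.keys m \<subseteq> {0..R} \<times> {1..N}"
      using assms m by (auto simp: mpoly_vars_def)
    from avg_poly_ind_prod_power[OF finite_keys this]
    have "avg_poly_ind N R (monomial_degree m) (monomial_eval m)"
      by (simp add: monomial_degree_def monomial_eval_def[abs_def])
    \<comment> \<open>The auxiliary product has done its work; the empty \<open>T\<close> gives the
      bound for the monomial alone.\<close>
    then show "avg_poly N R (monomial_degree m) (monomial_eval m)"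
      unfolding avg_poly_ind_def by (auto dest!: spec[of _ "{}"])
    show "monomial_degree m \<le> mpoly_degree p"
      using m mpoly_degree_le_iff by blast
  qed
  then show ?thesis
    unfolding mpoly_eval_def[abs_def] by (intro avg_poly_sum avg_poly_cmult)
qed

section \<open>Transfer of the approximation and comparison of degrees\<close>

lemma avg_close:
  assumes "x \<in> D_le N R" "\<And>y. y \<in> fiber N R x \<Longrightarrow> \<bar>g y - c\<bar> \<le> \<epsilon>"
  shows "\<bar>avg N R g x - c\<bar> \<le> \<epsilon>"
proof -
  let ?A = "fiber N R x"
  have pos: "real (card ?A) > 0"
    using fiber_nonempty[OF assms(1)] finite_fiber by (simp add: card_gt_0_iff)
  have "\<bar>\<Sum>y\<in>?A. g y - c\<bar> \<le> (\<Sum>y\<in>?A. \<bar>g y - c\<bar>)" by (rule sum_abs)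
  also have "\<dots> \<le> real (card ?A) * \<epsilon>" using assms(2) by (rule sum_bounded_above)
  finally have "\<bar>\<Sum>y\<in>?A. g y - c\<bar> / real (card ?A) \<le> \<epsilon>"
    using pos by (simp add: field_simps)
  moreover have "avg N R g x - c = (\<Sum>y\<in>?A. g y - c) / real (card ?A)"
    using pos by (simp add: avg_def sum_subtractf field_simps)
  ultimately show ?thesis using pos by simp
qed

theorem theorem3p9:
  fixes N R :: nat and F :: "(nat \<Rightarrow> real) \<Rightarrow> real" and \<epsilon> :: real
  assumes "N \<ge> 1" and "R \<ge> 1"
    and "F \<in> sign_cube {1..R} \<rightarrow> {-1, 1}"
    and "\<epsilon> > 0"
  shows "approx_deg ({0..R} \<times> {1..N}) \<epsilon> (D_prop N R) (comp_OR N R F)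
       \<ge> approx_deg ({1..R} \<times> {1..N}) \<epsilon> (D_le N R) (comp_OR N R F)"
proof -
  let ?G = "comp_OR N R F" and ?V = "{0..R} \<times> {1..N}"
  let ?P = "\<lambda>d. \<exists>p. mpoly_vars p \<subseteq> ?V \<and> mpoly_degree p = d \<and>
    (\<forall>x\<in>D_prop N R. \<bar>mpoly_eval p x - ?G x\<bar> \<le> \<epsilon>)"
  have "D_prop N R \<subseteq> sign_cube ?V" by (auto simp: D_prop_def)
  then obtain d f where "polyfun ?V d f" "\<And>x. x \<in> D_prop N R \<Longrightarrow> f x = ?G x"
    using polyfun_interpolation[of ?V "D_prop N R" ?G] by auto
  then have "\<exists>d. ?P d"
    using \<open>\<epsilon> > 0\<close> unfolding polyfun_def by force
  \<comment> \<open>Interpolation makes the set of degrees nonempty, so the least one is attained by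
    some polynomial.\<close>
  then have "?P (approx_deg ?V \<epsilon> (D_prop N R) ?G)"
    unfolding approx_deg_def by (rule LeastI_ex)
  then obtain p where p: "mpoly_vars p \<subseteq> ?V"
    "mpoly_degree p = approx_deg ?V \<epsilon> (D_prop N R) ?G"
    "\<And>y. y \<in> D_prop N R \<Longrightarrow> \<bar>mpoly_eval p y - ?G y\<bar> \<le> \<epsilon>"
    by blast
  obtain q where q: "mpoly_vars q \<subseteq> {1..R} \<times> {1..N}" "mpoly_degree q \<le> mpoly_degree p"
    "\<And>x. x \<in> D_le N R \<Longrightarrow> avg N R (mpoly_eval p) x = mpoly_eval q x"
    using avg_poly_mpoly_eval[OF p(1)] unfolding avg_poly_def polyfun_def by metis
  have "\<bar>mpoly_eval q x - ?G x\<bar> \<le> \<epsilon>" if x: "x \<in> D_le N R" for x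
  proof -
    \<comment> \<open>The target value is constant on the fiber, so the error bound at each
      \<open>y\<close> is a bound against the value at \<open>x\<close>.\<close>
    have "\<bar>mpoly_eval p y - ?G x\<bar> \<le> \<epsilon>" if "y \<in> fiber N R x" for y
      using p(3)[of y] comp_OR_fiber[OF x that] that by (simp add: fiber_def)
    with x have "\<bar>avg N R (mpoly_eval p) x - ?G x\<bar> \<le> \<epsilon>" by (rule avg_close)
    then show ?thesis using q(3)[OF x] by simp
  qed
  then have "approx_deg ({1..R} \<times> {1..N}) \<epsilon> (D_le N R) ?G \<le> mpoly_degree q"
    unfolding approx_deg_def using q(1) by (intro Least_le) blast
  with q(2) p(2) show ?thesis by simp
qed

end
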